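(* Let $k\ge 1$ and let $T_k$ be the real vector space of triangular arrays $A=(a_{ij})_{0\le i\le j\le k}$ with $a_{00}=0$. Define the linear map $\Phi_k\colon T_k\to T_k$ by $\Phi_k((a_{ij}))=(h_{ij})$ with $h_{ij}=\sum_{p=0}^{i}\sum_{q=p}^{j}a_{pq}$. Then $\Phi_k$ is a volume preserving linear operator (its determinant is $1$) which maps the Littlewood-Richardson cone $\mathsf{LR}_k$ bijectively onto the hive cone $\mathsf{H}_k$, and maps $\mathsf{LR}_k(\lambda,\mu,\nu)$ onto $\mathsf{H}_k(\lambda,\mu,\nu)$ for all $\lambda,\mu,\nu\in\mathsf{D}_k$.
   Context: $T_k$ is the vector space of all labelings $A=(a_{ij})_{0\le i\le j\le k}$ by real numbers with $a_{00}=0$ (dimension $\binom{k+2}{2}-1$). $\mathsf{D}_k$ denotes the set of $k$-tuples $\lambda=(\lambda_1,\dots,\lambda_k)$ of real numbers with $\lambda_1\ge\cdots\ge\lambda_k$, and $|\lambda|=\sum_i\lambda_i$. A Littlewood-Richardson triangle of size $k$ is $A=(a_{ij})\in T_k$ satisfying: (P) $a_{ij}\ge 0$ for all $1\le i<j\le k$; (CS) $\sum_{p=0}^{i-1}a_{pj}\ge\sum_{p=0}^{i}a_{p\,j+1}$ for all $1\le i\le j<k$; (LR) $\sum_{q=i}^{j}a_{iq}\ge\sum_{q=i+1}^{j+1}a_{i+1\,q}$ for all $1\le i\le j<k$. $\mathsf{LR}_k$ is the cone of all such triangles. Its type is $(\lambda,\mu,\nu)$ where $\mu_j=a_{0j}$,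 $\lambda_j=\sum_{p=0}^{j}a_{pj}$ ($1\le j\le k$), $\nu_i=\sum_{q=i}^{k}a_{iq}$ ($1\le i\le k$); $\mathsf{LR}_k(\lambda,\mu,\nu)$ is the set of Littlewood-Richardson triangles of type $(\lambda,\mu,\nu)$. A hive of size $k$ is $H=(h_{ij})_{0\le i\le j\le k}$ of real numbers with $h_{00}=0$ satisfying: (R) $h_{ij}-h_{i\,j-1}\ge h_{i-1\,j}-h_{i-1\,j-1}$ for $1\le i<j\le k$; (V) $h_{i-1\,j}-h_{i-1\,j-1}\ge h_{i\,j+1}-h_{ij}$ for $1\le i\le j<k$; (L) $h_{ij}-h_{i-1\,j}\ge h_{i+1\,j+1}-h_{i\,j+1}$ for $1\le i\le j<k$. $\mathsf{H}_k$ is the cone of all hives of size $k$. The type of a hive is $(\lambda,\mu,\nu)$ where $\mu_j=h_{0j}-h_{0\,j-1}$, $\lambda_j=h_{jj}-h_{j-1\,j-1}$ ($1\le j\le k$), $\nu_i=h_{ik}-h_{i-1\,k}$ ($1\le i\le k$); $\mathsf{H}_k(\lambda,\mu,\nu)$ is the set of hives of type $(\lambda,\mu,\nu)$. *)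

theory Defs
  imports "HOL-Analysis.Lebesgue_Measure" "Jordan_Normal_Form.Determinant"
begin

text \<open>A triangular array of size \<open>k\<close> is a function on pairs of naturals that vanishes off the
  triangle \<open>0 \<le> i \<le> j \<le> k\<close>, so that equality of arrays is equality of their entries.\<close>

type_synonym tri = "nat \<Rightarrow> nat \<Rightarrow> real"

definition T_space :: "nat \<Rightarrow> tri set" where
  "T_space k = {A. A 0 0 = 0 \<and> (\<forall>i j. \<not> (i \<le> j \<and> j \<le> k) \<longrightarrow> A i j = 0)}"

text \<open>Tuples are lists of length \<open>k\<close>; the informal \<open>\<lambda>\<^sub>j\<close> is the list entry at position \<open>j - 1\<close>.\<close>

definition D_cone :: "nat \<Rightarrow> real list set" where
  "D_cone k = {l. length l = k \<and> sorted_wrt (\<ge>) l}"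

definition LR_cone :: "nat \<Rightarrow> tri set" where
  "LR_cone k = {a \<in> T_space k.
     (\<forall>i j. 1 \<le> i \<and> i < j \<and> j \<le> k \<longrightarrow> a i j \<ge> 0) \<and>
     (\<forall>i j. 1 \<le> i \<and> i \<le> j \<and> j < k \<longrightarrow>
        (\<Sum>p=0..i-1. a p j) \<ge> (\<Sum>p=0..i. a p (j+1))) \<and>
     (\<forall>i j. 1 \<le> i \<and> i \<le> j \<and> j < k \<longrightarrow>
        (\<Sum>q=i..j. a i q) \<ge> (\<Sum>q=i+1..j+1. a (i+1) q))}"

definition LR_type :: "nat \<Rightarrow> tri \<Rightarrow> real list \<times> real list \<times> real list" where
  "LR_type k a =
     (map (\<lambda>j. \<Sum>p=0..j. a p j) [1..<k+1],
      map (\<lambda>j. a 0 j) [1..<k+1],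
      map (\<lambda>i. \<Sum>q=i..k. a i q) [1..<k+1])"

definition LR_of_type :: "nat \<Rightarrow> real list \<Rightarrow> real list \<Rightarrow> real list \<Rightarrow> tri set" where
  "LR_of_type k lam mu nu = {a \<in> LR_cone k. LR_type k a = (lam, mu, nu)}"

definition hive_cone :: "nat \<Rightarrow> tri set" where
  "hive_cone k = {h \<in> T_space k.
     (\<forall>i j. 1 \<le> i \<and> i < j \<and> j \<le> k \<longrightarrow>
        h i j - h i (j-1) \<ge> h (i-1) j - h (i-1) (j-1)) \<and>
     (\<forall>i j. 1 \<le> i \<and> i \<le> j \<and> j < k \<longrightarrow>
        h (i-1) j - h (i-1) (j-1) \<ge> h i (j+1) - h i j) \<and>
     (\<forall>i j. 1 \<le> i \<and> i \<le> j \<and> j < k \<longrightarrow>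
        h i j - h (i-1) j \<ge> h (i+1) (j+1) - h i (j+1))}"

definition hive_type :: "nat \<Rightarrow> tri \<Rightarrow> real list \<times> real list \<times> real list" where
  "hive_type k h =
     (map (\<lambda>j. h j j - h (j-1) (j-1)) [1..<k+1],
      map (\<lambda>j. h 0 j - h 0 (j-1)) [1..<k+1],
      map (\<lambda>i. h i k - h (i-1) k) [1..<k+1])"

definition hive_of_type :: "nat \<Rightarrow> real list \<Rightarrow> real list \<Rightarrow> real list \<Rightarrow> tri set" where
  "hive_of_type k lam mu nu = {h \<in> hive_cone k. hive_type k h = (lam, mu, nu)}"

definition Phi :: "nat \<Rightarrow> tri \<Rightarrow> tri" where
  "Phi k a = (\<lambda>i j. if i \<le> j \<and> j \<le> k then \<Sum>p=0..i. \<Sum>q=p..j. a p q else 0)"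

definition linear_operator :: "nat \<Rightarrow> (tri \<Rightarrow> tri) \<Rightarrow> bool" where
  "linear_operator k F \<longleftrightarrow>
     (\<forall>A\<in>T_space k. F A \<in> T_space k) \<and>
     (\<forall>A\<in>T_space k. \<forall>B\<in>T_space k. F (\<lambda>i j. A i j + B i j) = (\<lambda>i j. F A i j + F B i j)) \<and>
     (\<forall>c::real. \<forall>A\<in>T_space k. F (\<lambda>i j. c * A i j) = (\<lambda>i j. c * F A i j))"

definition coord_index :: "nat \<Rightarrow> (nat \<times> nat) set" where
  "coord_index k = {(i, j). i \<le> j \<and> j \<le> k \<and> (i, j) \<noteq> (0, 0)}"

text \<open>The determinant of an operator is that of its matrix in the standard basis of \<open>T_space k\<close>,
  listed in the order \<open>(0,1), (1,1), (0,2), (1,2), (2,2), \<dots>\<close>.\<close>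

definition coord_list :: "nat \<Rightarrow> (nat \<times> nat) list" where
  "coord_list k = concat (map (\<lambda>j. map (\<lambda>i. (i, j)) [0..<j+1]) [1..<k+1])"

lemma set_coord_list: "set (coord_list k) = coord_index k"
proof -
  have "set (coord_list k) = (\<Union>j\<in>{1..<k+1}. (\<lambda>i. (i, j)) ` {0..<j+1})"
    unfolding coord_list_def by (simp del: upt_Suc)
  also have "\<dots> = coord_index k"
    unfolding coord_index_def by (force simp: image_iff)
  finally show ?thesis .
qed

lemma distinct_coord_list: "distinct (coord_list k)"
  by (induction k) (auto simp: coord_list_def distinct_map inj_on_def)

definition unit_tri :: "nat \<times> nat \<Rightarrow> tri" where
  "unit_tri x = (\<lambda>i j. if (i, j) = x then 1 else 0)"

definition operator_matrix :: "nat \<Rightarrow> (tri \<Rightarrow> tri) \<Rightarrow> real mat" where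
  "operator_matrix k F =
     mat (length (coord_list k)) (length (coord_list k))
       (\<lambda>(r, c). case_prod (F (unit_tri (coord_list k ! c))) (coord_list k ! r))"

definition operator_det :: "nat \<Rightarrow> (tri \<Rightarrow> tri) \<Rightarrow> real" where
  "operator_det k F = Determinant.det (operator_matrix k F)"

text \<open>Volume on \<open>T_space k\<close> is Lebesgue measure in the coordinates \<open>a\<^sub>i\<^sub>j\<close>, \<open>(i,j) \<noteq> (0,0)\<close>.\<close>

definition coords :: "nat \<Rightarrow> tri \<Rightarrow> (nat \<times> nat \<Rightarrow> real)" where
  "coords k A = restrict (case_prod A) (coord_index k)"

definition coord_measure :: "nat \<Rightarrow> (nat \<times> nat \<Rightarrow> real) measure" where
  "coord_measure k = PiM (coord_index k) (\<lambda>_. lborel)"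

definition volume_preserving :: "nat \<Rightarrow> (tri \<Rightarrow> tri) \<Rightarrow> bool" where
  "volume_preserving k F \<longleftrightarrow>
     (\<forall>S. S \<subseteq> T_space k \<and> coords k ` S \<in> sets (coord_measure k) \<longrightarrow>
        coords k ` F ` S \<in> sets (coord_measure k) \<and>
        emeasure (coord_measure k) (coords k ` F ` S) = emeasure (coord_measure k) (coords k ` S))"

end

theory Submission imports Defs begin

text \<open>Discrete differences of \<open>h = Phi k a\<close> along rows, columns and the diagonal are partial
  row and column sums of \<open>a\<close>, which turns (P), (CS), (LR) into (R), (V), (L) and identifies the
  types; second differences invert the map.  Every \<open>h\<^sub>i\<^sub>j\<close> is \<open>a\<^sub>i\<^sub>j\<close> plus a sum of entries \<open>a\<^sub>p\<^sub>q\<close>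
  with \<open>p + q < i + j\<close>.  Hence the matrix is unitriangular, and the map is a composition of shears
  that each change one coordinate by a function of the others; by Fubini and translation
  invariance, shears preserve Lebesgue measure.\<close>

section \<open>Differences and the inverse\<close>

lemma Phi_row_diff:
  assumes "1 \<le> i" "i \<le> j" "j \<le> k"
  shows "Phi k a i j - Phi k a (i - 1) j = (\<Sum>q=i..j. a i q)"
proof -
  obtain m where "i = Suc m" using assms(1) by (cases i) auto
  then show ?thesis using assms by (simp add: Phi_def)
qed

lemma Phi_col_diff:
  assumes "i \<le> j" "j < k"
  shows "Phi k a i (j + 1) - Phi k a i j = (\<Sum>p=0..i. a p (j + 1))"
  using assms by (simp add: Phi_def sum_subtractf[symmetric])

text \<open>The step from \<open>(j, j)\<close> to \<open>(j + 1, j + 1)\<close> goes through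
  \<open>(j, j + 1)\<close>: a column sum, then the diagonal entry.\<close>

lemma Phi_diag_diff:
  assumes "j < k"
  shows "Phi k a (j + 1) (j + 1) - Phi k a j j = (\<Sum>p=0..j + 1. a p (j + 1))"
  using Phi_col_diff[of j j k a] Phi_row_diff[of "j + 1" "j + 1" k a] assms by simp

lemma Phi_in_T_space: "a \<in> T_space k \<Longrightarrow> Phi k a \<in> T_space k"
  by (auto simp: T_space_def Phi_def)

text \<open>The value 0 for \<open>i > j\<close> stands for an empty row sum, so that telescoping
  along a row can start at the diagonal.\<close>

definition row_diff :: "tri \<Rightarrow> tri" where
  "row_diff h i j = (if i \<le> j then h i j - (if i = 0 then 0 else h (i - 1) j) else 0)"

text \<open>For \<open>1 \<le> i < j \<le> k\<close> this is the mixed second difference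
  \<open>h i j - h (i - 1) j - h i (j - 1) + h (i - 1) (j - 1)\<close>.\<close>

definition Phi_inv :: "nat \<Rightarrow> tri \<Rightarrow> tri" where
  "Phi_inv k h = (\<lambda>i j. if i \<le> j \<and> j \<le> k
     then row_diff h i j - (if j = 0 then 0 else row_diff h i (j - 1)) else 0)"

lemma Phi_inv_in_T_space: "h \<in> T_space k \<Longrightarrow> Phi_inv k h \<in> T_space k"
  by (auto simp: T_space_def Phi_inv_def row_diff_def)

lemma sum_Phi_inv_row:
  assumes "i \<le> j" "j \<le> k"
  shows "(\<Sum>q=i..j. Phi_inv k h i q) = row_diff h i j"
  using assms
proof (induction j rule: dec_induct)
  case base
  then show ?case by (cases i) (simp_all add: Phi_inv_def row_diff_def)
next
  case (step n)
  then show ?case by (simp add: Phi_inv_def)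
qed

lemma sum_row_diff:
  "i \<le> j \<Longrightarrow> (\<Sum>p=0..i. row_diff h p j) = h i j"
  by (induction i) (simp_all add: row_diff_def)

lemma Phi_Phi_inv:
  assumes "h \<in> T_space k"
  shows "Phi k (Phi_inv k h) = h"
proof (intro ext)
  fix i j
  show "Phi k (Phi_inv k h) i j = h i j"
  proof (cases "i \<le> j \<and> j \<le> k")
    case True
    then have "Phi k (Phi_inv k h) i j = (\<Sum>p=0..i. row_diff h p j)"
      by (simp add: Phi_def sum_Phi_inv_row)
    then show ?thesis using True by (simp add: sum_row_diff)
  next
    case False
    then show ?thesis using assms by (auto simp: Phi_def T_space_def)
  qed
qed

lemma row_diff_Phi:
  assumes "i \<le> j" "j \<le> k"
  shows "row_diff (Phi k a) i j = (\<Sum>q=i..j. a i q)"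
proof (cases "i = 0")
  case True
  then show ?thesis using assms by (simp add: row_diff_def Phi_def)
next
  case False
  then show ?thesis using assms Phi_row_diff[of i j k a] by (simp add: row_diff_def)
qed

lemma Phi_inv_Phi:
  assumes "a \<in> T_space k"
  shows "Phi_inv k (Phi k a) = a"
proof (intro ext)
  fix i j
  show "Phi_inv k (Phi k a) i j = a i j"
  proof (cases "i \<le> j \<and> j \<le> k")
    case True
    show ?thesis
    proof (cases j)
      case 0
      then show ?thesis using True by (simp add: Phi_inv_def row_diff_Phi)
    next
      case (Suc m)
      show ?thesis
      proof (cases "i = j")
        case True
        \<comment> \<open>The subtracted term lies below the diagonal, outside the range of
          \<open>row_diff_Phi\<close>, and is 0 by definition. Unfolding \<open>row_diff\<close>
          only afterwards leaves the other term to \<open>row_diff_Phi\<close>.\<close>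
        then show ?thesis using Suc \<open>i \<le> j \<and> j \<le> k\<close>
          by (simp add: Phi_inv_def row_diff_Phi) (simp add: row_diff_def)
      next
        case False
        then show ?thesis using Suc True by (simp add: Phi_inv_def row_diff_Phi)
      qed
    qed
  next
    case False
    then show ?thesis using assms by (auto simp: Phi_inv_def T_space_def)
  qed
qed

section \<open>Cones and types\<close>

text \<open>The inequalities match one by one at each \<open>(i, j)\<close>: (V) and (L) compare the
  partial sums of (CS) and (LR), and (R) compares two sums along column \<open>j\<close> whose
  difference is \<open>a i j\<close>.\<close>

lemma Phi_in_hive_cone_iff:
  assumes a: "a \<in> T_space k"
  shows "Phi k a \<in> hive_cone k \<longleftrightarrow> a \<in> LR_cone k"
proof -
  let ?h = "Phi k a"
  have R: "?h i j - ?h i (j-1) \<ge> ?h (i-1) j - ?h (i-1) (j-1) \<longleftrightarrow> a i j \<ge> 0"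
    if ij: "1 \<le> i \<and> i < j \<and> j \<le> k" for i j
  proof -
    obtain m n where "i = Suc m" "j = Suc n" using ij by (cases i; cases j) auto
    then show ?thesis
      using ij Phi_col_diff[of i n k a] Phi_col_diff[of m n k a] by simp
  qed
  have V: "?h (i-1) j - ?h (i-1) (j-1) \<ge> ?h i (j+1) - ?h i j
      \<longleftrightarrow> (\<Sum>p=0..i-1. a p j) \<ge> (\<Sum>p=0..i. a p (j+1))"
    if "1 \<le> i \<and> i \<le> j \<and> j < k" for i j
  proof -
    have "i - 1 \<le> j - 1" "j - 1 < k" "j - 1 + 1 = j" using that by auto
    then show ?thesis
      using that Phi_col_diff[of i j k a] Phi_col_diff[of "i-1" "j-1" k a] by simp
  qed
  have L: "?h i j - ?h (i-1) j \<ge> ?h (i+1) (j+1) - ?h i (j+1)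
      \<longleftrightarrow> (\<Sum>q=i..j. a i q) \<ge> (\<Sum>q=i+1..j+1. a (i+1) q)"
    if "1 \<le> i \<and> i \<le> j \<and> j < k" for i j
    using that Phi_row_diff[of i j k a] Phi_row_diff[of "i+1" "j+1" k a] by simp
  show ?thesis
    unfolding hive_cone_def LR_cone_def mem_Collect_eq
    by (intro conj_cong all_cong1 imp_cong refl R V L) (simp_all add: a Phi_in_T_space)
qed

lemma hive_type_Phi: "hive_type k (Phi k a) = LR_type k a"
proof -
  have "Phi k a j j - Phi k a (j-1) (j-1) = (\<Sum>p=0..j. a p j)"
       "Phi k a 0 j - Phi k a 0 (j-1) = a 0 j"
       "Phi k a j k - Phi k a (j-1) k = (\<Sum>q=j..k. a j q)"
    if "j \<in> set [1..<k+1]" for j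
    using that Phi_diag_diff[of "j-1" k a] Phi_col_diff[of 0 "j-1" k a] Phi_row_diff[of j k k a]
    by (auto simp del: upt_Suc)
  then show ?thesis
    unfolding hive_type_def LR_type_def by (simp del: upt_Suc)
qed

lemma bij_betw_LR_hive: "bij_betw (Phi k) (LR_cone k) (hive_cone k)"
proof (rule bij_betw_byWitness[where f' = "Phi_inv k"])
  have LR: "LR_cone k \<subseteq> T_space k" and hive: "hive_cone k \<subseteq> T_space k"
    by (auto simp: LR_cone_def hive_cone_def)
  show "\<forall>a\<in>LR_cone k. Phi_inv k (Phi k a) = a" using LR Phi_inv_Phi by auto
  show "\<forall>h\<in>hive_cone k. Phi k (Phi_inv k h) = h" using hive Phi_Phi_inv by auto
  show "Phi k ` LR_cone k \<subseteq> hive_cone k" using LR Phi_in_hive_cone_iff by auto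
  \<comment> \<open>The equivalence of the cones is used at the array \<open>Phi_inv k h\<close>,
    which \<open>Phi k\<close> sends back to \<open>h\<close>.\<close>
  show "Phi_inv k ` hive_cone k \<subseteq> LR_cone k"
  proof (rule image_subsetI)
    fix h assume h: "h \<in> hive_cone k"
    then show "Phi_inv k h \<in> LR_cone k"
      using hive Phi_in_hive_cone_iff[OF Phi_inv_in_T_space] Phi_Phi_inv by (metis subsetD)
  qed
qed

lemma Phi_image_LR_of_type:
  "Phi k ` LR_of_type k lam mu nu = hive_of_type k lam mu nu"
  using bij_betw_imp_surj_on[OF bij_betw_LR_hive[of k]]
  unfolding LR_of_type_def hive_of_type_def by (fastforce simp: hive_type_Phi)

section \<open>Linearity and determinant\<close>

lemma linear_operator_Phi: "linear_operator k (Phi k)"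
  unfolding linear_operator_def
  by (auto simp: Phi_in_T_space) (auto simp: Phi_def fun_eq_iff sum.distrib sum_distrib_left)

text \<open>The matrix of \<open>Phi\<close> is thus the zeta matrix of the componentwise order on
  index pairs.\<close>

lemma Phi_unit_tri:
  assumes "p \<le> q" "i \<le> j" "j \<le> k"
  shows "Phi k (unit_tri (p, q)) i j = (if p \<le> i \<and> q \<le> j then 1 else 0)"
proof -
  have "(\<Sum>q'=p'..j. unit_tri (p, q) p' q') = (if p' = p \<and> q \<le> j then 1 else 0)" for p'
    using assms by (cases "p' = p") (simp_all add: unit_tri_def)
  then have "Phi k (unit_tri (p, q)) i j = (\<Sum>p'=0..i. if p' = p then if q \<le> j then 1 else 0 else 0)"
    using assms by (auto simp: Phi_def intro!: sum.cong)
  then show ?thesis by (simp add:)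
qed

text \<open>Column-first lexicographic order extends the componentwise order, so no pair is
  componentwise below one listed before it. This puts zeros above the diagonal of the matrix of
  \<open>Phi\<close>.\<close>

lemma sorted_coord_list:
  "sorted_wrt (\<lambda>(p, q) (i, j). q < j \<or> q = j \<and> p < i) (coord_list k)"
proof (induction k)
  case 0
  then show ?case by (simp add: coord_list_def)
next
  case (Suc k)
  have "coord_list (Suc k) = coord_list k @ map (\<lambda>i. (i, Suc k)) [0..<Suc k + 1]"
    by (simp add: coord_list_def)
  moreover have "sorted_wrt (\<lambda>(p, q) (i, j). q < j \<or> q = j \<and> p < i)
      (map (\<lambda>i. (i, Suc k)) [0..<n])" for n
    by (simp add: sorted_wrt_map)
  ultimately show ?case using Suc
    by (auto simp del: upt_Suc simp: sorted_wrt_append set_coord_list coord_index_def)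
qed

lemma operator_det_Phi: "operator_det k (Phi k) = 1"
proof -
  let ?xs = "coord_list k"
  let ?n = "length ?xs"
  let ?A = "operator_matrix k (Phi k)"
  have carrier: "?A \<in> carrier_mat ?n ?n" by (simp add: operator_matrix_def)
  have nth_in: "?xs ! r \<in> coord_index k" if "r < ?n" for r
    using that nth_mem set_coord_list by blast
  have entry: "?A $$ (r, c) =
      (if fst (?xs ! c) \<le> fst (?xs ! r) \<and> snd (?xs ! c) \<le> snd (?xs ! r) then 1 else 0)"
    if "r < ?n" "c < ?n" for r c
  proof -
    obtain p q i j where "?xs ! c = (p, q)" "?xs ! r = (i, j)" by (metis surj_pair)
    then show ?thesis
      using that nth_in[of r] nth_in[of c]
      by (simp add: operator_matrix_def coord_index_def Phi_unit_tri)
  qed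
  have "?A $$ (r, c) = 0" if "r < c" "c < ?n" for r c
    using sorted_wrt_nth_less[OF sorted_coord_list[of k] that] that entry[of r c]
    by (auto simp: case_prod_beta)
  then have "Determinant.det ?A = prod_list (diag_mat ?A)"
    using carrier by (rule det_lower_triangular)
  also have "diag_mat ?A = replicate ?n 1"
    using carrier entry by (auto simp: diag_mat_def intro!: nth_equalityI)
  finally show ?thesis by (simp add: operator_det_def)
qed

section \<open>Volume\<close>

definition shear :: "'i \<Rightarrow> (('i \<Rightarrow> real) \<Rightarrow> real) \<Rightarrow> ('i \<Rightarrow> real) \<Rightarrow> 'i \<Rightarrow> real" where
  "shear x g f = f(x := f x + g f)"

lemma measurable_shear:
  assumes "x \<in> I" and "g \<in> borel_measurable (PiM I (\<lambda>_. lborel))"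
  shows "shear x g \<in> PiM I (\<lambda>_. lborel) \<rightarrow>\<^sub>M PiM I (\<lambda>_. lborel)"
proof (rule measurable_PiM_single')
  let ?M = "PiM I (\<lambda>_. lborel)"
  fix i assume "i \<in> I"
  have comp: "(\<lambda>f. f i) \<in> borel_measurable ?M" if "i \<in> I" for i
    using measurable_component_singleton[OF that, of "\<lambda>_. lborel"] by simp
  show "(\<lambda>f. shear x g f i) \<in> ?M \<rightarrow>\<^sub>M lborel"
    using comp[OF \<open>i \<in> I\<close>] comp[OF assms(1)] assms(2)
    by (cases "i = x") (simp_all add: shear_def)
next
  show "shear x g \<in> space (PiM I (\<lambda>_. lborel)) \<rightarrow> I \<rightarrow>\<^sub>E space lborel"
    using assms(1) by (auto simp: shear_def space_PiM PiE_iff extensional_def)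
qed

text \<open>With the other coordinates fixed, \<open>g\<close> is constant, so the shear translates
  each line in direction \<open>x\<close>. Fubini with \<open>x\<close> as inner variable assembles
  the lines.\<close>

lemma emeasure_shear_vimage:
  fixes g :: "('i \<Rightarrow> real) \<Rightarrow> real"
  assumes "finite I" "x \<in> I" and g: "g \<in> borel_measurable (PiM I (\<lambda>_. lborel))"
    and indep: "\<And>f c. g (f(x := c)) = g f"
    and S: "S \<in> sets (PiM I (\<lambda>_. lborel))"
  shows "emeasure (PiM I (\<lambda>_. lborel)) (shear x g -` S \<inter> space (PiM I (\<lambda>_. lborel)))
       = emeasure (PiM I (\<lambda>_. lborel)) S"
proof -
  interpret product_sigma_finite "\<lambda>_ :: 'i. lborel :: real measure" ..
  let ?M = "PiM I (\<lambda>_. lborel :: real measure)"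
  let ?J = "I - {x}"
  have I: "insert x ?J = I" using assms(2) by auto
  have ms: "shear x g \<in> ?M \<rightarrow>\<^sub>M ?M" using assms(2) g by (rule measurable_shear)
  have Fubini: "(\<integral>\<^sup>+f. u f \<partial>?M) = (\<integral>\<^sup>+f. (\<integral>\<^sup>+y. u (f(x := y)) \<partial>lborel) \<partial>PiM ?J (\<lambda>_. lborel))"
    if "u \<in> borel_measurable ?M" for u
    using product_nn_integral_insert[of ?J x u, unfolded I] that assms(1) by simp
  have "emeasure ?M (shear x g -` S \<inter> space ?M) = (\<integral>\<^sup>+f. indicator S (shear x g f) \<partial>?M)"
    using S ms by (simp add: nn_integral_distr[symmetric] emeasure_distr)
  also have "\<dots> = (\<integral>\<^sup>+f. (\<integral>\<^sup>+y. indicator S (f(x := y + g f)) \<partial>lborel) \<partial>PiM ?J (\<lambda>_. lborel))"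
    using S ms by (subst Fubini, measurable) (simp add: shear_def indep)
  also have "\<dots> = (\<integral>\<^sup>+f. (\<integral>\<^sup>+y. indicator S (f(x := y)) \<partial>lborel) \<partial>PiM ?J (\<lambda>_. lborel))"
  proof (rule nn_integral_cong)
    fix f assume f: "f \<in> space (PiM ?J (\<lambda>_. lborel :: real measure))"
    have "(\<lambda>y. f(x := y)) \<in> lborel \<rightarrow>\<^sub>M ?M"
      using measurable_component_update[OF f, of x] unfolding I by simp
    then have "(\<lambda>y. indicator S (f(x := y)) :: ennreal) \<in> borel_measurable borel"
      using S by simp
    \<comment> \<open>Slope 1 and offset \<open>g f\<close> make the substitution a translation,
      \<open>f\<close> being fixed by the outer integral.\<close>
    from nn_integral_real_affine[OF this, of 1 "g f"]
    show "(\<integral>\<^sup>+y. indicator S (f(x := y + g f)) \<partial>lborel) = (\<integral>\<^sup>+y. indicator S (f(x := y)) \<partial>lborel)"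
      by (simp add: add.commute)
  qed
  also have "\<dots> = (\<integral>\<^sup>+f. indicator S f \<partial>?M)"
    using S by (subst Fubini) simp_all
  finally show ?thesis using S by simp
qed

text \<open>By \<open>indep\<close>, shearing by \<open>- g\<close> inverts the shear, so the image
  is a preimage under a shear.\<close>

lemma emeasure_shear_image:
  fixes g :: "('i \<Rightarrow> real) \<Rightarrow> real"
  assumes "finite I" "x \<in> I" and g: "g \<in> borel_measurable (PiM I (\<lambda>_. lborel))"
    and indep: "\<And>f c. g (f(x := c)) = g f"
    and S: "S \<in> sets (PiM I (\<lambda>_. lborel))"
  shows "shear x g ` S \<in> sets (PiM I (\<lambda>_. lborel))"
    and "emeasure (PiM I (\<lambda>_. lborel)) (shear x g ` S) = emeasure (PiM I (\<lambda>_. lborel)) S"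
proof -
  let ?M = "PiM I (\<lambda>_. lborel :: real measure)"
  let ?g' = "\<lambda>f. - g f"
  have g': "?g' \<in> borel_measurable ?M" using g by simp
  have inv: "shear x ?g' (shear x g f) = f" "shear x g (shear x ?g' f) = f" for f
    by (simp_all add: shear_def indep)
  have "shear x g f \<in> space ?M" if "f \<in> S" for f
    using measurable_space[OF measurable_shear[OF assms(2) g]] sets.sets_into_space[OF S] that
    by blast
  then have image: "shear x g ` S = shear x ?g' -` S \<inter> space ?M"
    by (auto simp: inv) (metis image_eqI inv(2))
  show "shear x g ` S \<in> sets ?M"
    unfolding image using measurable_shear[OF assms(2) g'] S by (rule measurable_sets)
  show "emeasure ?M (shear x g ` S) = emeasure ?M S"
    unfolding image using assms(1,2) g' _ S by (rule emeasure_shear_vimage) (simp add: indep)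
qed

text \<open>The simultaneous update is a composition of shears in order of non-increasing rank: by
  \<open>indep\<close>, \<open>g z\<close> reads only coordinates of rank below that of
  \<open>z\<close>, which are still unchanged when \<open>z\<close> is sheared.\<close>

lemma emeasure_triangular_image:
  fixes g :: "'i \<Rightarrow> ('i \<Rightarrow> real) \<Rightarrow> real" and rank :: "'i \<Rightarrow> nat"
  assumes "finite I" and "J \<subseteq> I"
    and g: "\<And>z. z \<in> I \<Longrightarrow> g z \<in> borel_measurable (PiM I (\<lambda>_. lborel))"
    and indep: "\<And>z x f c. rank z \<le> rank x \<Longrightarrow> g z (f(x := c)) = g z f"
    and S: "S \<in> sets (PiM I (\<lambda>_. lborel))"
  shows "(\<lambda>f z. if z \<in> J then f z + g z f else f z) ` S \<in> sets (PiM I (\<lambda>_. lborel)) \<and>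
    emeasure (PiM I (\<lambda>_. lborel)) ((\<lambda>f z. if z \<in> J then f z + g z f else f z) ` S)
      = emeasure (PiM I (\<lambda>_. lborel)) S"
  using finite_subset[OF assms(2,1)] assms(2) S
\<comment> \<open>\<open>S\<close> is arbitrary because the induction hypothesis is applied to the
  set sheared at \<open>x\<close>.\<close>
proof (induction J arbitrary: S rule: finite_ranking_induct[where f = rank])
  case empty
  then show ?case by simp
next
  case (insert x J)
  let ?F = "\<lambda>J f z. if z \<in> J then f z + g z f else f z"
  show ?case
  proof (cases "x \<in> J")
    case True
    then show ?thesis using insert.IH insert.prems by (simp add: insert_absorb)
  next
    case False
    \<comment> \<open>Since \<open>x\<close> has maximal rank, the coordinates in \<open>J\<close> do not see the shear at \<open>x\<close>.\<close>
    have "?F (insert x J) f = ?F J (shear x (g x) f)" for f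
      using False insert.hyps(2) indep by (auto simp: shear_def fun_eq_iff)
    then have image: "?F (insert x J) ` S = ?F J ` shear x (g x) ` S"
      by (simp add: image_image)
    have x: "x \<in> I" using insert.prems by simp
    note sh = emeasure_shear_image[where g = "g x", OF assms(1) x g[OF x] indep[OF order_refl]
        insert.prems(2)]
    show ?thesis
      unfolding image using insert.IH[OF _ sh(1)] sh(2) insert.prems(1) by simp
  qed
qed

section \<open>The map \<open>Phi\<close> as a triangular change of coordinates\<close>

lemma finite_coord_index: "finite (coord_index k)"
  by (metis List.finite_set set_coord_list)

definition below :: "nat \<Rightarrow> nat \<times> nat \<Rightarrow> (nat \<times> nat) set" where
  "below k z = {y \<in> coord_index k. fst y \<le> fst z \<and> snd y \<le> snd z \<and> y \<noteq> z}"

lemma Phi_eq_add_sum_below: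
  assumes a: "a \<in> T_space k" and ij: "(i, j) \<in> coord_index k"
  shows "Phi k a i j = a i j + (\<Sum>(p, q)\<in>below k (i, j). a p q)"
proof -
  let ?B = "below k (i, j)"
  have fin: "finite ?B" using finite_coord_index by (simp add: below_def)
  have "Phi k a i j = (\<Sum>(p, q)\<in>(SIGMA p:{0..i}. {p..j}). a p q)"
    using ij by (simp add: Phi_def coord_index_def sum.Sigma)
  \<comment> \<open>Apart from \<open>(i, j)\<close> itself, only \<open>(0, 0)\<close> is missing
    from \<open>?B\<close>; it is no coordinate, and its entry vanishes in
    \<open>T_space\<close>.\<close>
  also have "(SIGMA p:{0..i}. {p..j}) = insert (0, 0) (insert (i, j) ?B)"
    using ij by (auto simp: below_def coord_index_def)
  also have "(\<Sum>(p, q)\<in>insert (0, 0) (insert (i, j) ?B). a p q)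
      = a 0 0 + (\<Sum>(p, q)\<in>insert (i, j) ?B. a p q)"
    using fin ij by (subst sum.insert) (auto simp: below_def coord_index_def)
  also have "\<dots> = a i j + (\<Sum>(p, q)\<in>?B. a p q)"
    using fin a by (subst sum.insert) (auto simp: below_def T_space_def)
  finally show ?thesis .
qed

text \<open>This is the form treated by \<open>emeasure_triangular_image\<close> with
  \<open>J\<close> the whole index set; off that set both sides are
  \<open>undefined\<close>.\<close>

lemma coords_Phi:
  assumes "a \<in> T_space k"
  shows "coords k (Phi k a) = (\<lambda>z. if z \<in> coord_index k
     then coords k a z + (\<Sum>y\<in>below k z. coords k a y) else coords k a z)"
proof
  fix z :: "nat \<times> nat"
  obtain i j where z: "z = (i, j)" by (cases z)
  have "(\<Sum>y\<in>below k z. coords k a y) = (\<Sum>(p, q)\<in>below k z. a p q)"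
    by (rule sum.cong) (auto simp: below_def coords_def)
  then show "coords k (Phi k a) z = (if z \<in> coord_index k
     then coords k a z + (\<Sum>y\<in>below k z. coords k a y) else coords k a z)"
    using Phi_eq_add_sum_below[OF assms, of i j] z by (simp add: coords_def)
qed

lemma volume_preserving_Phi: "volume_preserving k (Phi k)"
  unfolding volume_preserving_def
proof (intro allI impI)
  fix S assume S: "S \<subseteq> T_space k \<and> coords k ` S \<in> sets (coord_measure k)"
  let ?I = "coord_index k"
  let ?g = "\<lambda>z f. \<Sum>y\<in>below k z. f y :: real"
  let ?F = "\<lambda>f z. if z \<in> ?I then f z + ?g z f else f z"
  have meas: "?g z \<in> borel_measurable (PiM ?I (\<lambda>_. lborel))" if "z \<in> ?I" for z
  proof (rule borel_measurable_sum)
    fix y assume "y \<in> below k z"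
    then have "y \<in> ?I" by (simp add: below_def)
    then show "(\<lambda>f. f y) \<in> borel_measurable (PiM ?I (\<lambda>_. lborel))"
      using measurable_component_singleton[of y ?I "\<lambda>_. lborel"] by simp
  qed
  \<comment> \<open>An index in \<open>below k z\<close> has a strictly smaller coordinate sum than
    \<open>z\<close>, so it cannot be \<open>x\<close>; the coordinate sum therefore serves as
    rank.\<close>
  have indep: "?g z (f(x := c)) = ?g z f" if "fst z + snd z \<le> fst x + snd x" for z x f c
  proof (rule sum.cong)
    fix y assume "y \<in> below k z"
    then have "y \<noteq> x" using that by (auto simp: below_def prod_eq_iff)
    then show "(f(x := c)) y = f y" by simp
  qed simp
  have "coords k ` Phi k ` S = ?F ` coords k ` S"
    using S coords_Phi by (auto simp: image_image intro!: image_cong)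
  then show "coords k ` Phi k ` S \<in> sets (coord_measure k) \<and>
      emeasure (coord_measure k) (coords k ` Phi k ` S) = emeasure (coord_measure k) (coords k ` S)"
    using emeasure_triangular_image[where rank = "\<lambda>z. fst z + snd z" and g = ?g and J = ?I,
        OF finite_coord_index order_refl meas indep] S
    by (simp add: coord_measure_def)
qed

theorem theorem4p1:
  fixes k :: nat
  assumes "k \<ge> 1"
  shows "linear_operator k (Phi k)
       \<and> volume_preserving k (Phi k)
       \<and> operator_det k (Phi k) = 1
       \<and> bij_betw (Phi k) (LR_cone k) (hive_cone k)
       \<and> (\<forall>lam\<in>D_cone k. \<forall>mu\<in>D_cone k. \<forall>nu\<in>D_cone k.
            Phi k ` LR_of_type k lam mu nu = hive_of_type k lam mu nu)"
  by (intro conjI ballI linear_operator_Phi volume_preserving_Phi operator_det_Phi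
      bij_betw_LR_hive Phi_image_LR_of_type)

end
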